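(* Let $N\ge 1$ be an integer, let $p\ge 2$ be real, and set $\gamma := \frac{2}{N(p-1)}$. There exists a constant $C=C(N,p)>0$, depending only on $N$ and $p$, such that the following holds. Let $J:\mathbb{R}^N\to[0,+\infty)$ be a measurable function and let $r,R>0$ be such that $J(z)\ge r$ for all $|z|<R$. Then $$\mathcal{D}_p^J(u)\;\ge\; C\,r\,\min\left\{ R^{N+2}\,\|u\|_1^{-p\gamma}\,\|u\|_p^{p(1+\gamma)},\; R^N\,\|u\|_p^p\right\}$$ for all $u\in L^1(\mathbb{R}^N)\cap L^p(\mathbb{R}^N)$.
   Context: $\|\cdot\|_q$ denotes the norm of $L^q(\mathbb{R}^N)$. For $q>0$ let $\phi_q(s):=|s|^q\,\mathrm{sgn}(s)$, $s\in\mathbb{R}$. For a measurable (real-valued) function $u:\mathbb{R}^N\to\mathbb{R}$ the $L^p$ dissipation is $$\mathcal{D}_p^J(u):=\frac p2\int_{\mathbb{R}^N}\int_{\mathbb{R}^N}J(x-y)\,\big(u(x)-u(y)\big)\big(\phi_{p-1}(u(x))-\phi_{p-1}(u(y))\big)\,dx\,dy\in[0,+\infty].$$ *)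

theory Defs
  imports "HOL-Analysis.Analysis"
begin

(* Functions are representatives of L^q classes; "measurable" means Lebesgue measurable. *)
definition in_Lq :: "real \<Rightarrow> (real ^ 'n \<Rightarrow> real) \<Rightarrow> bool" where
  "in_Lq q u \<longleftrightarrow>
     u \<in> borel_measurable lebesgue \<and> integrable lebesgue (\<lambda>x. \<bar>u x\<bar> powr q)"

(* Only meaningful for functions satisfying in_Lq q: the Bochner integral is 0 when the
   q-th power is not integrable. *)
definition Lq_norm :: "real \<Rightarrow> (real ^ 'n \<Rightarrow> real) \<Rightarrow> real" where
  "Lq_norm q u = (LINT x|lebesgue. \<bar>u x\<bar> powr q) powr (1 / q)"

definition phi :: "real \<Rightarrow> real \<Rightarrow> real" where
  "phi q s = \<bar>s\<bar> powr q * sgn s"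

(* For J nonnegative and p > 1 the integrand is nonnegative because phi (p - 1) is
   increasing, so truncation by ennreal loses nothing and the value in [0,\<infinity>] is always defined. *)
definition dissipation ::
    "real \<Rightarrow> (real ^ 'n \<Rightarrow> real) \<Rightarrow> (real ^ 'n \<Rightarrow> real) \<Rightarrow> ennreal" where
  "dissipation p J u =
     ennreal (p / 2) *
       (\<integral>\<^sup>+ y. (\<integral>\<^sup>+ x. ennreal (J (x - y) * ((u x - u y) * (phi (p - 1) (u x) - phi (p - 1) (u y))))
          \<partial>lebesgue) \<partial>lebesgue)"

end

theory Submission
  imports Defs
begin

text \<open>
  Put \<open>v = phi (p / 2) u\<close>, so that \<open>v\<^sup>2 = \<bar>u\<bar> powr p\<close>. The elementary inequality
  \<open>(v x - v y)\<^sup>2 \<le> p * ((u x - u y) * (phi (p - 1) (u x) - phi (p - 1) (u y)))\<close>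
  bounds the dissipation below by a multiple of \<open>r * E R\<close>, where \<open>E \<rho>\<close> is the double integral
  of \<open>(v x - v y)\<^sup>2\<close> over the pairs at distance less than \<open>\<rho>\<close>. It remains to prove a
  Nash inequality for \<open>E R\<close>, which rests on two facts.

  First, at a large enough scale \<open>\<rho>\<close> the energy controls the full norm. Let \<open>A\<close> and \<open>P\<close> be the
  integrals of \<open>\<bar>u\<bar>\<close> and \<open>\<bar>u\<bar> powr p\<close>. Choose a level \<open>t\<close> so low that the points with
  \<open>\<bar>u\<bar> \<le> 2 * t\<close> contribute at most half of \<open>P\<close>, and \<open>\<rho>\<close> so large that a ball of radius \<open>\<rho>\<close>
  has volume at least \<open>2 * A / t\<close>. By Markov's inequality \<open>\<bar>u\<bar> \<le> t\<close> on at least half of each such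
  ball, so every \<open>y\<close> with \<open>\<bar>u y\<bar> > 2 * t\<close> sees a difference \<open>\<bar>v x - v y\<bar>\<close> comparable with
  \<open>\<bar>v y\<bar>\<close> for half of the \<open>x\<close> around it (lemma \<open>increment_energy_ge\<close>).

  Second, \<open>E (2 * \<rho>) \<le> 2 ^ (N + 2) * E \<rho>\<close>: an increment of step \<open>2 * h\<close> is a sum of two of
  step \<open>h\<close> (factor \<open>4\<close>), and rescaling the steps costs \<open>2 ^ N\<close> (lemma
  \<open>increment_energy_double\<close>). Repeated doubling of \<open>R\<close> either needs no
  step at all, when \<open>\<rho> \<le> R\<close>, or first passes \<open>\<rho>\<close> at a scale of at most \<open>2 * \<rho>\<close>; these two
  cases give the two terms of the minimum (lemma \<open>increment_energy_Nash\<close>).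
\<close>

section \<open>Pointwise inequalities for signed powers\<close>

lemma phi_minus: "phi q (- s) = - phi q s"
  by (simp add: phi_def)

lemma phi_nonneg: "0 \<le> s \<Longrightarrow> phi q s = s powr q"
  by (cases "s = 0") (auto simp: phi_def)

lemma abs_phi: "\<bar>phi q s\<bar> = \<bar>s\<bar> powr q"
  by (cases "s = 0") (auto simp: phi_def abs_mult)

lemma phi_half_power2: "(phi (p / 2) s)\<^sup>2 = \<bar>s\<bar> powr p"
proof -
  have "(phi (p / 2) s)\<^sup>2 = (\<bar>s\<bar> powr (p / 2))\<^sup>2"
    by (metis abs_phi power2_abs)
  then show ?thesis
    by (simp add: power2_eq_square flip: powr_add)
qed

lemma powr_diff_le_tangent:
  fixes a b q :: real
  assumes "1 \<le> q" "0 \<le> b" "b \<le> a"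
  shows "a powr q - b powr q \<le> q * (a - b) * a powr (q - 1)"
proof (cases "b = 0 \<or> b = a")
  case True
  have "a powr q = a * a powr (q - 1)"
    using assms by (cases "a = 0") (auto simp: powr_diff)
  moreover have "1 * (a * a powr (q - 1)) \<le> q * (a * a powr (q - 1))"
    using assms by (intro mult_right_mono) auto
  ultimately show ?thesis using True assms by (auto simp: algebra_simps)
next
  case False
  then have b: "0 < b" "b < a" using assms by auto
  have "\<exists>z>b. z < a \<and> a powr q - b powr q = (a - b) * (q * z powr (q - 1))"
    using b by (intro MVT2) (auto intro!: derivative_eq_intros simp: powr_diff field_simps)
  then obtain z where z: "b < z" "z < a" "a powr q - b powr q = (a - b) * (q * z powr (q - 1))"
    by blast
  have "z powr (q - 1) \<le> a powr (q - 1)"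
    using z b assms by (intro powr_mono2) auto
  then have "(a - b) * (q * z powr (q - 1)) \<le> (a - b) * (q * a powr (q - 1))"
    using b assms by (intro mult_left_mono) auto
  then show ?thesis using z by (simp add: algebra_simps)
qed

text \<open>
  The arguments are compared after a reduction to \<open>a \<ge> 0\<close>: if both have the same sign, the
  tangent bound applies; if the signs differ, \<open>(x + y)\<^sup>2 \<le> 2 * (x\<^sup>2 + y\<^sup>2)\<close> and \<open>2 \<le> p\<close> suffice.
\<close>

lemma phi_half_diff_power2_le:
  fixes p a b :: real
  assumes p: "2 \<le> p"
  shows "(phi (p / 2) a - phi (p / 2) b)\<^sup>2 \<le> p * ((a - b) * (phi (p - 1) a - phi (p - 1) b))"
proof -
  have same: "(phi (p / 2) a - phi (p / 2) b)\<^sup>2 \<le> p * ((a - b) * (phi (p - 1) a - phi (p - 1) b))"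
    if "0 \<le> b" "b \<le> a" for a b :: real
  proof -
    let ?d = "a powr (p / 2) - b powr (p / 2)"
    have d0: "0 \<le> ?d" using that p by (simp add: powr_mono2)
    have d1: "?d \<le> p / 2 * (a - b) * a powr (p / 2 - 1)"
      using powr_diff_le_tangent[of "p / 2" b a] that p by simp
    have *: "a powr (p - 1) = a powr (p / 2 - 1) * a powr (p / 2)"
      "b powr (p - 1) = b powr (p / 2 - 1) * b powr (p / 2)"
      by (simp_all flip: powr_add)
    have "b powr (p / 2 - 1) * b powr (p / 2) \<le> a powr (p / 2 - 1) * b powr (p / 2)"
      using that p by (intro mult_right_mono powr_mono2) auto
    then have d2: "a powr (p / 2 - 1) * ?d \<le> a powr (p - 1) - b powr (p - 1)"
      unfolding * by (simp add: algebra_simps)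
    have "?d\<^sup>2 \<le> p / 2 * (a - b) * a powr (p / 2 - 1) * ?d"
      unfolding power2_eq_square using d1 d0 by (intro mult_right_mono)
    also have "\<dots> = p / 2 * (a - b) * (a powr (p / 2 - 1) * ?d)" by simp
    also have "\<dots> \<le> p / 2 * (a - b) * (a powr (p - 1) - b powr (p - 1))"
      using that p by (intro mult_left_mono d2) auto
    also have "\<dots> \<le> p * (a - b) * (a powr (p - 1) - b powr (p - 1))"
      using that p by (intro mult_right_mono) (auto simp: powr_mono2)
    finally show ?thesis using that by (simp add: phi_nonneg mult.assoc)
  qed
  have opp: "(phi (p / 2) a - phi (p / 2) (- c))\<^sup>2
      \<le> p * ((a - - c) * (phi (p - 1) a - phi (p - 1) (- c)))"
    if "0 \<le> a" "0 \<le> c" for a c :: real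
  proof -
    have *: "x powr p = x * x powr (p - 1)" if "0 \<le> x" for x :: real
      using that by (cases "x = 0") (auto simp: powr_diff)
    have "(a powr (p / 2) + c powr (p / 2))\<^sup>2 \<le> 2 * ((a powr (p / 2))\<^sup>2 + (c powr (p / 2))\<^sup>2)"
      using zero_le_power2[of "a powr (p / 2) - c powr (p / 2)"]
      by (simp add: power2_eq_square algebra_simps)
    also have "\<dots> = 2 * (a powr p + c powr p)"
      by (simp add: power2_eq_square flip: powr_add)
    also have "\<dots> \<le> 2 * ((a + c) * (a powr (p - 1) + c powr (p - 1)))"
      using that by (simp add: * algebra_simps)
    also have "\<dots> \<le> p * ((a + c) * (a powr (p - 1) + c powr (p - 1)))"
      using that p by (intro mult_right_mono) auto
    finally show ?thesis using that by (simp add: phi_minus phi_nonneg)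
  qed
  have nonneg: "(phi (p / 2) a - phi (p / 2) b)\<^sup>2 \<le> p * ((a - b) * (phi (p - 1) a - phi (p - 1) b))"
    if "0 \<le> a" for a b :: real
  proof -
    consider "0 \<le> b" "b \<le> a" | "a \<le> b" | "b < 0" by linarith
    then show ?thesis
    proof cases
      case 2
      then show ?thesis
        using same[of a b] that by (simp add: power2_commute algebra_simps)
    next
      case 3
      then show ?thesis using opp[of a "- b"] that by simp
    qed (use same in auto)
  qed
  show ?thesis
  proof (cases "0 \<le> a")
    case False
    then show ?thesis
      using nonneg[of "- a" "- b"] by (simp add: phi_minus power2_commute algebra_simps)
  qed (rule nonneg)
qed

lemma phi_half_diff_power2_ge:
  fixes p a b :: real
  assumes p: "2 \<le> p" and ab: "2 * \<bar>b\<bar> \<le> \<bar>a\<bar>"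
  shows "\<bar>a\<bar> powr p / 4 \<le> (phi (p / 2) a - phi (p / 2) b)\<^sup>2"
proof -
  have "2 * \<bar>b\<bar> powr (p / 2) \<le> 2 powr (p / 2) * \<bar>b\<bar> powr (p / 2)"
    using p powr_mono[of 1 "p / 2" 2] by (intro mult_right_mono) auto
  also have "\<dots> = (2 * \<bar>b\<bar>) powr (p / 2)" by (simp add: powr_mult)
  also have "\<dots> \<le> \<bar>a\<bar> powr (p / 2)" using ab p by (intro powr_mono2) auto
  finally have "2 * \<bar>phi (p / 2) b\<bar> \<le> \<bar>phi (p / 2) a\<bar>" by (simp add: abs_phi)
  then have "\<bar>phi (p / 2) a / 2\<bar> \<le> \<bar>phi (p / 2) a - phi (p / 2) b\<bar>" by linarith
  then have "(phi (p / 2) a / 2)\<^sup>2 \<le> (phi (p / 2) a - phi (p / 2) b)\<^sup>2"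
    by (rule abs_le_square_iff[THEN iffD1])
  then show ?thesis by (simp add: power_divide phi_half_power2)
qed

section \<open>The energy of increments and its dependence on the scale\<close>

text \<open>
  The integral of \<open>(v x - v y)\<^sup>2\<close> over the pairs with \<open>dist x y < \<rho>\<close>, written with the increment
  \<open>h = x - y\<close> as outer variable so that doubling the scale acts on \<open>h\<close> alone. It may be infinite.
\<close>

definition increment_energy :: "real \<Rightarrow> ('a::euclidean_space \<Rightarrow> real) \<Rightarrow> ennreal" where
  "increment_energy \<rho> v =
     (\<integral>\<^sup>+ h. (\<integral>\<^sup>+ y. ennreal ((v (y + h) - v y)\<^sup>2) \<partial>lborel) * indicator (ball 0 \<rho>) h \<partial>lborel)"

lemma nn_integral_lborel_translate:
  fixes f :: "'a::euclidean_space \<Rightarrow> ennreal"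
  assumes [measurable]: "f \<in> borel_measurable borel"
  shows "(\<integral>\<^sup>+ x. f (c + x) \<partial>lborel) = (\<integral>\<^sup>+ x. f x \<partial>lborel)"
proof -
  have "(\<integral>\<^sup>+ x. f x \<partial>lborel) = (\<integral>\<^sup>+ x. f x \<partial>distr lborel borel ((+) c))"
    by (simp add: lborel_distr_plus)
  also have "\<dots> = (\<integral>\<^sup>+ x. f (c + x) \<partial>lborel)"
    by (subst nn_integral_distr) auto
  finally show ?thesis ..
qed

lemma nn_integral_lborel_scale:
  fixes f :: "'a::euclidean_space \<Rightarrow> ennreal"
  assumes [measurable]: "f \<in> borel_measurable borel" and c: "0 < c"
  shows "(\<integral>\<^sup>+ x. f x \<partial>lborel) = ennreal (c ^ DIM('a)) * (\<integral>\<^sup>+ x. f (c *\<^sub>R x) \<partial>lborel)"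
proof -
  have "(\<integral>\<^sup>+ x. f x \<partial>lborel)
      = (\<integral>\<^sup>+ x. f x \<partial>density (distr lborel borel (\<lambda>x::'a. 0 + c *\<^sub>R x)) (\<lambda>_. \<bar>c\<bar> ^ DIM('a)))"
    by (rule arg_cong[where f = "\<lambda>M. nn_integral M f"], rule lborel_affine) (use c in auto)
  also have "\<dots> = (\<integral>\<^sup>+ x. ennreal (\<bar>c\<bar> ^ DIM('a)) * f (c *\<^sub>R x) \<partial>lborel)"
    by (subst nn_integral_density; (subst nn_integral_distr)?) auto
  also have "\<dots> = ennreal (c ^ DIM('a)) * (\<integral>\<^sup>+ x. f (c *\<^sub>R x) \<partial>lborel)"
    using c by (subst nn_integral_cmult) auto
  finally show ?thesis .
qed

lemma increment_energy_eq_ball: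
  fixes v :: "'a::euclidean_space \<Rightarrow> real"
  assumes [measurable]: "v \<in> borel_measurable borel"
  shows "increment_energy \<rho> v =
    (\<integral>\<^sup>+ y. (\<integral>\<^sup>+ x. ennreal ((v x - v y)\<^sup>2) * indicator (ball y \<rho>) x \<partial>lborel) \<partial>lborel)"
proof -
  have [measurable]: "ball c \<rho> \<in> sets borel" for c :: 'a by simp
  have "increment_energy \<rho> v =
      (\<integral>\<^sup>+ h. (\<integral>\<^sup>+ y. ennreal ((v (y + h) - v y)\<^sup>2) * indicator (ball 0 \<rho>) h \<partial>lborel) \<partial>lborel)"
    unfolding increment_energy_def by (subst nn_integral_multc) auto
  also have "\<dots> =
      (\<integral>\<^sup>+ y. (\<integral>\<^sup>+ h. ennreal ((v (y + h) - v y)\<^sup>2) * indicator (ball 0 \<rho>) h \<partial>lborel) \<partial>lborel)"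
    by (rule lborel_pair.Fubini') measurable
  also have "\<dots> =
      (\<integral>\<^sup>+ y. (\<integral>\<^sup>+ x. ennreal ((v x - v y)\<^sup>2) * indicator (ball y \<rho>) x \<partial>lborel) \<partial>lborel)"
  proof (rule nn_integral_cong)
    fix y :: 'a
    have "ennreal ((v (y + h) - v y)\<^sup>2) * indicator (ball 0 \<rho>) h
        = ennreal ((v (y + h) - v y)\<^sup>2) * indicator (ball y \<rho>) (y + h)" for h
      by (simp add: indicator_def dist_norm)
    then show "(\<integral>\<^sup>+ h. ennreal ((v (y + h) - v y)\<^sup>2) * indicator (ball 0 \<rho>) h \<partial>lborel) =
        (\<integral>\<^sup>+ x. ennreal ((v x - v y)\<^sup>2) * indicator (ball y \<rho>) x \<partial>lborel)"
      using nn_integral_lborel_translate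
        [of "\<lambda>x. ennreal ((v x - v y)\<^sup>2) * indicator (ball y \<rho>) x" y]
      by simp
  qed
  finally show ?thesis .
qed

lemma nn_integral_increment_double:
  fixes v :: "'a::euclidean_space \<Rightarrow> real"
  assumes [measurable]: "v \<in> borel_measurable borel"
  shows "(\<integral>\<^sup>+ y. ennreal ((v (y + 2 *\<^sub>R h) - v y)\<^sup>2) \<partial>lborel)
    \<le> 4 * (\<integral>\<^sup>+ y. ennreal ((v (y + h) - v y)\<^sup>2) \<partial>lborel)"
proof -
  let ?f = "\<lambda>y. ennreal ((v (y + h) - v y)\<^sup>2)"
  have "(v (y + 2 *\<^sub>R h) - v y)\<^sup>2 \<le> 2 * (v (h + y + h) - v (h + y))\<^sup>2 + 2 * (v (y + h) - v y)\<^sup>2"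
    for y
  proof -
    have *: "y + 2 *\<^sub>R h = h + y + h" "h + y = y + h"
      by (simp_all add: scaleR_2 algebra_simps)
    have "(a - c)\<^sup>2 \<le> 2 * (a - b)\<^sup>2 + 2 * (b - c)\<^sup>2" for a b c :: real
      using zero_le_power2[of "a - 2 * b + c"] by (simp add: power2_eq_square algebra_simps)
    from this[of "v (y + h + h)" "v y" "v (y + h)"] show ?thesis
      unfolding * by simp
  qed
  then have "ennreal ((v (y + 2 *\<^sub>R h) - v y)\<^sup>2) \<le> 2 * ?f (h + y) + 2 * ?f y" for y
    by (subst (1 2) ennreal_numeral[symmetric])
      (simp only: ennreal_leI zero_le_power2 zero_le_numeral mult_nonneg_nonneg
        flip: ennreal_mult ennreal_plus)
  then have "(\<integral>\<^sup>+ y. ennreal ((v (y + 2 *\<^sub>R h) - v y)\<^sup>2) \<partial>lborel)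
      \<le> (\<integral>\<^sup>+ y. 2 * ?f (h + y) + 2 * ?f y \<partial>lborel)"
    by (intro nn_integral_mono)
  also have "\<dots> = 2 * (\<integral>\<^sup>+ y. ?f (h + y) \<partial>lborel) + 2 * (\<integral>\<^sup>+ y. ?f y \<partial>lborel)"
    by (subst nn_integral_add) (auto simp: nn_integral_cmult)
  also have "(\<integral>\<^sup>+ y. ?f (h + y) \<partial>lborel) = (\<integral>\<^sup>+ y. ?f y \<partial>lborel)"
    by (rule nn_integral_lborel_translate) auto
  also have "2 * (\<integral>\<^sup>+ y. ?f y \<partial>lborel) + 2 * (\<integral>\<^sup>+ y. ?f y \<partial>lborel) = 4 * (\<integral>\<^sup>+ y. ?f y \<partial>lborel)"
    by (simp flip: distrib_right)
  finally show ?thesis .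
qed

lemma increment_energy_double:
  fixes v :: "'a::euclidean_space \<Rightarrow> real"
  assumes [measurable]: "v \<in> borel_measurable borel"
  shows "increment_energy (2 * \<rho>) v \<le> ennreal (2 ^ (DIM('a) + 2)) * increment_energy \<rho> v"
proof -
  have [measurable]: "ball (0 :: 'a) r \<in> sets borel" for r by (rule borel_open) simp
  let ?G = "\<lambda>h. (\<integral>\<^sup>+ y. ennreal ((v (y + h) - v y)\<^sup>2) \<partial>lborel)"
  have "(\<integral>\<^sup>+ h. ?G (2 *\<^sub>R h) * indicator (ball 0 (2 * \<rho>)) (2 *\<^sub>R h) \<partial>lborel)
      \<le> (\<integral>\<^sup>+ h. 4 * (?G h * indicator (ball 0 \<rho>) h) \<partial>lborel)"
  proof (rule nn_integral_mono)
    fix h :: 'a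
    have "indicator (ball 0 (2 * \<rho>)) (2 *\<^sub>R h) = (indicator (ball 0 \<rho>) h :: ennreal)"
      by (simp add: indicator_def)
    then show "?G (2 *\<^sub>R h) * indicator (ball 0 (2 * \<rho>)) (2 *\<^sub>R h)
        \<le> 4 * (?G h * indicator (ball 0 \<rho>) h)"
      using mult_right_mono[OF nn_integral_increment_double[OF assms, of h],
          of "indicator (ball 0 \<rho>) h"] by (simp add: mult.assoc)
  qed
  also have "\<dots> = 4 * increment_energy \<rho> v"
    unfolding increment_energy_def by (rule nn_integral_cmult) measurable
  finally have le: "(\<integral>\<^sup>+ h. ?G (2 *\<^sub>R h) * indicator (ball 0 (2 * \<rho>)) (2 *\<^sub>R h) \<partial>lborel)
      \<le> 4 * increment_energy \<rho> v" .
  have "increment_energy (2 * \<rho>) v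
      = ennreal (2 ^ DIM('a)) * (\<integral>\<^sup>+ h. ?G (2 *\<^sub>R h) * indicator (ball 0 (2 * \<rho>)) (2 *\<^sub>R h) \<partial>lborel)"
    unfolding increment_energy_def
    by (rule nn_integral_lborel_scale)
      (measurable, auto intro!: open_Collect_less continuous_intros)
  also have "\<dots> \<le> ennreal (2 ^ DIM('a)) * (4 * increment_energy \<rho> v)"
    by (rule mult_left_mono[OF le]) simp
  also have "\<dots> = ennreal (2 ^ DIM('a) * 4) * increment_energy \<rho> v"
    by (simp add: ennreal_mult mult.assoc)
  finally show ?thesis by (simp add: power_add mult.commute)
qed

lemma increment_energy_double_iterate:
  fixes v :: "'a::euclidean_space \<Rightarrow> real"
  assumes "v \<in> borel_measurable borel"
  shows "increment_energy (2 ^ m * \<rho>) v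
    \<le> ennreal ((2 ^ m) ^ (DIM('a) + 2)) * increment_energy \<rho> v"
proof (induction m)
  case (Suc m)
  have "increment_energy (2 ^ Suc m * \<rho>) v
      \<le> ennreal (2 ^ (DIM('a) + 2)) * increment_energy (2 ^ m * \<rho>) v"
    using increment_energy_double[OF assms, of "2 ^ m * \<rho>"] by (simp add: mult.assoc)
  also have "\<dots> \<le> ennreal (2 ^ (DIM('a) + 2))
      * (ennreal ((2 ^ m) ^ (DIM('a) + 2)) * increment_energy \<rho> v)"
    by (intro mult_left_mono Suc) auto
  also have "\<dots> = ennreal ((2 ^ Suc m) ^ (DIM('a) + 2)) * increment_energy \<rho> v"
    by (simp only: power_Suc power_mult_distrib ennreal_mult mult.assoc zero_le_power
        zero_le_numeral)
  finally show ?case .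
qed simp

text \<open>
  The hypothesis \<open>low\<close> makes the part of the \<open>p\<close>-th power integral below the level \<open>2 * t\<close> at most
  one half of the whole, and \<open>big\<close> makes \<open>\<bar>u\<bar> > t\<close> fail on at least half of each ball.
\<close>

lemma increment_energy_ge:
  fixes u :: "'a::euclidean_space \<Rightarrow> real"
  assumes [measurable]: "u \<in> borel_measurable borel" and p: "2 \<le> p"
    and int1: "integrable lborel u"
    and intp: "integrable lborel (\<lambda>x. \<bar>u x\<bar> powr p)"
    and lam: "0 < t"
    and low: "(2 * t) powr (p - 1) * (\<integral>x. \<bar>u x\<bar> \<partial>lborel) \<le> (\<integral>x. \<bar>u x\<bar> powr p \<partial>lborel) / 2"
    and big: "2 * (\<integral>x. \<bar>u x\<bar> \<partial>lborel) / t \<le> unit_ball_vol (DIM('a)) * \<rho> ^ DIM('a)"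
    and rho: "0 < \<rho>"
  shows "ennreal (unit_ball_vol (DIM('a)) * \<rho> ^ DIM('a) * (\<integral>x. \<bar>u x\<bar> powr p \<partial>lborel) / 16)
    \<le> increment_energy \<rho> (\<lambda>x. phi (p / 2) (u x))"
proof -
  define A where "A = (\<integral>x. \<bar>u x\<bar> \<partial>lborel)"
  define P where "P = (\<integral>x. \<bar>u x\<bar> powr p \<partial>lborel)"
  define V where "V = unit_ball_vol (DIM('a)) * \<rho> ^ DIM('a)"
  have V: "0 < V" using rho by (simp add: V_def unit_ball_vol_pos)
  have [measurable]: "(\<lambda>x. phi (p / 2) (u x)) \<in> borel_measurable borel"
    unfolding phi_def by measurable
  have mball: "measure lborel (ball y \<rho>) = V" for y :: 'a
    using content_ball[of \<rho> y] rho by (simp add: V_def)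
  \<comment> \<open>Markov's inequality bounds the bad set, hence its part in every ball.\<close>
  have emarkov: "emeasure lborel {x. t < \<bar>u x\<bar>} \<le> ennreal (A / t)"
  proof -
    have "emeasure lborel {x. t < \<bar>u x\<bar>} \<le> emeasure lborel {x\<in>space lborel. t \<le> \<bar>u x\<bar>}"
      by (intro emeasure_mono) auto
    also have "\<dots> \<le> ennreal (1 / t * A)"
      unfolding A_def using int1 lam by (intro integral_Markov_inequality) auto
    finally show ?thesis by simp
  qed
  have dens: "ennreal (V / 2) \<le> emeasure lborel (ball y \<rho> \<inter> {x. \<bar>u x\<bar> \<le> t})" for y :: 'a
  proof -
    have "ennreal V = emeasure lborel (ball y \<rho>)"
      using emeasure_eq_ennreal_measure[of lborel "ball y \<rho>"] mball emeasure_bounded_finite[of "ball y \<rho>"]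
      by auto
    also have "\<dots> \<le> emeasure lborel ((ball y \<rho> \<inter> {x. \<bar>u x\<bar> \<le> t}) \<union> {x. t < \<bar>u x\<bar>})"
      by (intro emeasure_mono) auto
    also have "\<dots> \<le> emeasure lborel (ball y \<rho> \<inter> {x. \<bar>u x\<bar> \<le> t}) + emeasure lborel {x. t < \<bar>u x\<bar>}"
      by (intro emeasure_subadditive) auto
    also have "\<dots> \<le> emeasure lborel (ball y \<rho> \<inter> {x. \<bar>u x\<bar> \<le> t}) + ennreal (V / 2)"
      using big by (intro add_left_mono order.trans[OF emarkov] ennreal_leI)
        (simp add: A_def V_def mult.commute)
    finally have "ennreal V - ennreal (V / 2) \<le> emeasure lborel (ball y \<rho> \<inter> {x. \<bar>u x\<bar> \<le> t})"
      by (subst ennreal_minus_le_iff) (auto simp: add.commute)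
    then show ?thesis using V by (simp add: ennreal_minus)
  qed
  have inner: "ennreal (V / 8) * ennreal (\<bar>u y\<bar> powr p * indicator {x. 2 * t < \<bar>u x\<bar>} y)
      \<le> (\<integral>\<^sup>+ x. ennreal ((phi (p / 2) (u x) - phi (p / 2) (u y))\<^sup>2) * indicator (ball y \<rho>) x \<partial>lborel)"
    (is "_ \<le> ?I") for y
  proof (cases "2 * t < \<bar>u y\<bar>")
    case True
    have "ennreal (V / 8) * ennreal (\<bar>u y\<bar> powr p) = ennreal (\<bar>u y\<bar> powr p / 4) * ennreal (V / 2)"
      using V by (simp flip: ennreal_mult)
    also have "\<dots> \<le> ennreal (\<bar>u y\<bar> powr p / 4) * emeasure lborel (ball y \<rho> \<inter> {x. \<bar>u x\<bar> \<le> t})"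
      by (intro mult_left_mono dens) auto
    also have "\<dots> = (\<integral>\<^sup>+ x. ennreal (\<bar>u y\<bar> powr p / 4) * indicator (ball y \<rho> \<inter> {x. \<bar>u x\<bar> \<le> t}) x \<partial>lborel)"
      by (subst nn_integral_cmult_indicator) auto
    also have "\<dots> \<le> ?I"
    proof (rule nn_integral_mono)
      fix x
      show "ennreal (\<bar>u y\<bar> powr p / 4) * indicator (ball y \<rho> \<inter> {x. \<bar>u x\<bar> \<le> t}) x
        \<le> ennreal ((phi (p / 2) (u x) - phi (p / 2) (u y))\<^sup>2) * indicator (ball y \<rho>) x"
        using phi_half_diff_power2_ge[OF p, of "u x" "u y"] True
        by (auto simp: indicator_def power2_commute intro!: ennreal_leI)
    qed
    finally show ?thesis using True by simp
  qed auto
  have intu: "integrable lborel (\<lambda>x. \<bar>u x\<bar>)" using int1 by auto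
  have inth: "integrable lborel (\<lambda>y. \<bar>u y\<bar> powr p * indicator {x. 2 * t < \<bar>u x\<bar>} y)"
    using intp by (intro integrable_real_mult_indicator) auto
  have high: "P / 2 \<le> (\<integral>y. \<bar>u y\<bar> powr p * indicator {x. 2 * t < \<bar>u x\<bar>} y \<partial>lborel)"
  proof -
    have "P \<le> (\<integral>y. \<bar>u y\<bar> powr p * indicator {x. 2 * t < \<bar>u x\<bar>} y
        + (2 * t) powr (p - 1) * \<bar>u y\<bar> \<partial>lborel)"
      unfolding P_def
    proof (intro integral_mono intp Bochner_Integration.integrable_add inth integrable_mult_right intu)
      fix y
      show "\<bar>u y\<bar> powr p \<le> \<bar>u y\<bar> powr p * indicator {x. 2 * t < \<bar>u x\<bar>} y
          + (2 * t) powr (p - 1) * \<bar>u y\<bar>"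
      proof (cases "2 * t < \<bar>u y\<bar>")
        case False
        have "\<bar>u y\<bar> powr p = \<bar>u y\<bar> powr (p - 1) * \<bar>u y\<bar>"
          by (cases "u y = 0") (auto simp: powr_diff)
        also have "\<dots> \<le> (2 * t) powr (p - 1) * \<bar>u y\<bar>"
          using False p by (intro mult_right_mono powr_mono2) auto
        finally show ?thesis using False by simp
      qed simp
    qed
    also have "\<dots> = (\<integral>y. \<bar>u y\<bar> powr p * indicator {x. 2 * t < \<bar>u x\<bar>} y \<partial>lborel)
        + (2 * t) powr (p - 1) * A"
      using inth intu by (simp add: A_def)
    finally show ?thesis using low by (simp add: A_def P_def)
  qed
  have "ennreal (V * P / 16) = ennreal (V / 8) * ennreal (P / 2)"
    using V by (simp add: P_def flip: ennreal_mult)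
  also have "\<dots> \<le> ennreal (V / 8) *
      ennreal (\<integral>y. \<bar>u y\<bar> powr p * indicator {x. 2 * t < \<bar>u x\<bar>} y \<partial>lborel)"
    by (intro mult_left_mono ennreal_leI high) auto
  also have "\<dots> = ennreal (V / 8) *
      (\<integral>\<^sup>+ y. ennreal (\<bar>u y\<bar> powr p * indicator {x. 2 * t < \<bar>u x\<bar>} y) \<partial>lborel)"
    by (subst nn_integral_eq_integral[OF inth]) auto
  also have "\<dots> = (\<integral>\<^sup>+ y. ennreal (V / 8) *
      ennreal (\<bar>u y\<bar> powr p * indicator {x. 2 * t < \<bar>u x\<bar>} y) \<partial>lborel)"
    by (subst nn_integral_cmult) auto
  also have "\<dots> \<le> increment_energy \<rho> (\<lambda>x. phi (p / 2) (u x))"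
    by (subst increment_energy_eq_ball) (auto intro!: nn_integral_mono inner)
  finally show ?thesis by (simp add: V_def P_def)
qed


section \<open>The Nash inequality and the dissipation estimate\<close>

text \<open>
  The level \<open>t\<close> and the scale \<open>\<rho>\<close> are chosen so that both smallness conditions of
  \<open>increment_energy_ge\<close> hold with equality at the scale \<open>\<rho>\<close>; then
  \<open>P / \<rho>\<^sup>2 = K * A powr (- p * \<gamma>) * P powr (1 + \<gamma>)\<close>, which explains the exponents.
\<close>

lemma increment_energy_Nash:
  fixes u :: "'a::euclidean_space \<Rightarrow> real"
  assumes u: "u \<in> borel_measurable borel" and p: "2 \<le> p"
    and int1: "integrable lborel u"
    and intp: "integrable lborel (\<lambda>x. \<bar>u x\<bar> powr p)"
    and R: "0 < R"
    and gam: "\<gamma> = 2 / (real DIM('a) * (p - 1))"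
  defines "A \<equiv> (\<integral>x. \<bar>u x\<bar> \<partial>lborel)"
    and "P \<equiv> (\<integral>x. \<bar>u x\<bar> powr p \<partial>lborel)"
    and "\<omega> \<equiv> unit_ball_vol (real DIM('a))"
  defines "K \<equiv> (\<omega> / 4 * 2 powr (- 1 / (p - 1))) powr (2 / real DIM('a))"
  shows "ennreal (\<omega> * min 1 K / 64 *
      min (R ^ (DIM('a) + 2) * A powr (- p * \<gamma>) * P powr (1 + \<gamma>)) (R ^ DIM('a) * P))
    \<le> increment_energy R (\<lambda>x. phi (p / 2) (u x))"
proof (cases "P = 0")
  case False
  define N where "N = real DIM('a)"
  have N: "0 < N" by (simp add: N_def)
  have P: "0 < P" using False by (simp add: P_def order_less_le)
  have "A \<noteq> 0"
  proof
    assume "A = 0"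
    then have "AE x in lborel. \<bar>u x\<bar> = 0"
      using integral_nonneg_eq_0_iff_AE[of lborel "\<lambda>x. \<bar>u x\<bar>"] int1 by (simp add: A_def)
    then have "AE x in lborel. \<bar>u x\<bar> powr p = 0" by eventually_elim simp
    then have "P = 0" unfolding P_def by (rule integral_eq_zero_AE)
    with P show False by simp
  qed
  then have A: "0 < A" by (simp add: A_def order_less_le)
  have w: "0 < \<omega>" by (simp add: \<omega>_def unit_ball_vol_pos)
  define t where "t = (P / (2 * A)) powr (1 / (p - 1)) / 2"
  have t: "0 < t" using A P by (simp add: t_def)
  have tp: "(2 * t) powr (p - 1) = P / (2 * A)"
    using A P p by (simp add: t_def powr_powr)
  define \<rho> where "\<rho> = (2 * A / (t * \<omega>)) powr (1 / N)"
  have rho: "0 < \<rho>" using A t w by (simp add: \<rho>_def)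
  have rhoN: "\<omega> * \<rho> ^ DIM('a) = 2 * A / t"
    using A t w N by (simp add: \<rho>_def N_def powr_powr flip: powr_realpow)
  \<comment> \<open>The number of doublings of \<open>R\<close> needed to reach \<open>\<rho>\<close>; it is \<open>0\<close> if \<open>\<rho> \<le> R\<close>.\<close>
  obtain m :: nat where m: "\<rho> \<le> 2 ^ m * R" "2 ^ m \<le> max 1 (2 * \<rho> / R)"
  proof -
    define m where "m = (LEAST m. \<rho> \<le> 2 ^ m * R)"
    obtain n where "\<rho> / R < 2 ^ n" using real_arch_pow[of 2 "\<rho> / R"] by auto
    then have "\<rho> \<le> 2 ^ n * R" using R by (simp add: field_simps)
    then have m1: "\<rho> \<le> 2 ^ m * R" unfolding m_def by (rule LeastI)
    have "2 ^ m \<le> max 1 (2 * \<rho> / R)"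
    proof (cases m)
      case (Suc k)
      then have "\<not> \<rho> \<le> 2 ^ k * R" using not_less_Least[of k "\<lambda>m. \<rho> \<le> 2 ^ m * R"] by (simp add: m_def)
      then have "2 ^ m \<le> 2 * \<rho> / R" using R Suc by (simp add: field_simps)
      then show ?thesis by simp
    qed simp
    with m1 show thesis by (rule that)
  qed
  have big: "2 * A / t \<le> \<omega> * (2 ^ m * R) ^ DIM('a)"
    unfolding rhoN[symmetric] using m rho w by (intro mult_left_mono power_mono) auto
  have low: "(2 * t) powr (p - 1) * A \<le> P / 2"
    using tp A by simp
  have "ennreal (\<omega> * (2 ^ m * R) ^ DIM('a) * P / 16)
      \<le> increment_energy (2 ^ m * R) (\<lambda>x. phi (p / 2) (u x))"
    using R unfolding P_def \<omega>_def
    by (intro increment_energy_ge[OF u p int1 intp t low[unfolded A_def P_def]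
        big[unfolded A_def \<omega>_def]]) simp
  also have "\<dots> \<le> ennreal ((2 ^ m) ^ (DIM('a) + 2)) * increment_energy R (\<lambda>x. phi (p / 2) (u x))"
    using u by (intro increment_energy_double_iterate) (auto simp: phi_def)
  finally have "ennreal (1 / (2 ^ m) ^ (DIM('a) + 2)) * ennreal (\<omega> * (2 ^ m * R) ^ DIM('a) * P / 16)
      \<le> ennreal (1 / (2 ^ m) ^ (DIM('a) + 2)) *
        (ennreal ((2 ^ m) ^ (DIM('a) + 2)) * increment_energy R (\<lambda>x. phi (p / 2) (u x)))"
    by (rule mult_left_mono) simp
  also have "\<dots> = increment_energy R (\<lambda>x. phi (p / 2) (u x))"
    by (subst mult.assoc[symmetric], subst ennreal_mult[symmetric]) auto
  also have "ennreal (1 / (2 ^ m) ^ (DIM('a) + 2)) * ennreal (\<omega> * (2 ^ m * R) ^ DIM('a) * P / 16)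
      = ennreal (\<omega> * (R ^ DIM('a) * P) / (16 * (2 ^ m)\<^sup>2))"
    using w R P
    by (subst ennreal_mult[symmetric]) (auto simp: power_mult_distrib power_add power2_eq_square)
  finally have E: "ennreal (\<omega> * (R ^ DIM('a) * P) / (16 * (2 ^ m)\<^sup>2))
      \<le> increment_energy R (\<lambda>x. phi (p / 2) (u x))" .
  let ?X = "R ^ (DIM('a) + 2) * A powr (- p * \<gamma>) * P powr (1 + \<gamma>)"
  let ?Y = "R ^ DIM('a) * P"
  have X0: "0 \<le> ?X" and Y0: "0 \<le> ?Y" using R P by auto
  have K0: "0 \<le> K" by (simp add: K_def)
  have rho2: "P / \<rho>\<^sup>2 = K * A powr (- p * \<gamma>) * P powr (1 + \<gamma>)"
  proof -
    let ?s = "1 / (p - 1)"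
    have A_inv: "A powr (- (?s + 1)) = 1 / (A powr ?s * A)"
      using A by (subst powr_minus_divide, subst powr_add) simp
    have "1 / \<rho>\<^sup>2 = \<rho> powr (- 2)"
      using rho by (simp add: powr_minus_divide)
    also have "\<dots> = (2 * A / (t * \<omega>)) powr (- (2 / N))"
      by (simp add: \<rho>_def powr_powr)
    also have "\<dots> = (t * \<omega> / (2 * A)) powr (2 / N)"
      using A t w by (simp add: powr_minus powr_divide)
    also have "t * \<omega> / (2 * A) = (\<omega> / 4 * 2 powr (- 1 / (p - 1))) * (P powr ?s * A powr (- (?s + 1)))"
      using A P unfolding A_inv by (simp add: t_def powr_divide powr_mult powr_minus field_simps)
    also have "\<dots> powr (2 / N) = K * (P powr (?s * (2 / N)) * A powr (- (?s + 1) * (2 / N)))"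
      using A P w by (simp only: powr_mult powr_powr K_def N_def)
    also have "?s * (2 / N) = \<gamma>" by (simp add: gam N_def)
    also have "- (?s + 1) * (2 / N) = - p * \<gamma>"
      using p N by (simp add: gam N_def[symmetric] field_simps)
    finally show ?thesis using P by (simp add: powr_add divide_inverse)
  qed
  have "\<omega> * min 1 K / 64 * min ?X ?Y \<le> \<omega> * ?Y / (16 * (2 ^ m)\<^sup>2)"
  \<comment> \<open>Without doubling the second term of the minimum is used, otherwise \<open>2 ^ m \<le> 2 * \<rho> / R\<close>
    produces the first.\<close>
  proof (cases "(2::real) ^ m \<le> 1")
    case True
    have "m = 0"
    proof (rule ccontr)
      assume "m \<noteq> 0"
      then have "(1::real) < 2 ^ m" by (intro one_less_power) auto
      with True show False by simp
    qed
    moreover have "min 1 K * min ?X ?Y \<le> 1 * ?Y"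
      using X0 Y0 K0 by (intro mult_mono) auto
    ultimately have "\<omega> * (min 1 K * min ?X ?Y) \<le> \<omega> * ?Y" using w by (intro mult_left_mono) auto
    moreover have "0 \<le> \<omega> * ?Y" using w Y0 by simp
    ultimately show ?thesis using \<open>m = 0\<close> by simp
  next
    case False
    then have "2 ^ m \<le> 2 * \<rho> / R" using m(2) by (simp add: max_def split: if_splits)
    then have "(2 ^ m)\<^sup>2 \<le> (2 * \<rho> / R)\<^sup>2" by (rule power_mono) simp
    then have le: "(2 ^ m)\<^sup>2 * R\<^sup>2 \<le> 4 * \<rho>\<^sup>2"
      using R by (simp add: power_divide power_mult_distrib field_simps)
    have "min 1 K * min ?X ?Y \<le> K * ?X"
      using X0 Y0 K0 by (intro mult_mono) auto
    also have "\<dots> = R ^ (DIM('a) + 2) * (P / \<rho>\<^sup>2)" unfolding rho2 by simp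
    also have "\<dots> \<le> 4 * ?Y / (2 ^ m)\<^sup>2"
    proof -
      have "?Y * ((2 ^ m)\<^sup>2 * R\<^sup>2) \<le> ?Y * (4 * \<rho>\<^sup>2)"
        using le Y0 by (rule mult_left_mono)
      then show ?thesis using rho by (simp add: field_simps power_add power2_eq_square)
    qed
    finally have "\<omega> / 64 * (min 1 K * min ?X ?Y) \<le> \<omega> / 64 * (4 * ?Y / (2 ^ m)\<^sup>2)"
      using w by (intro mult_left_mono) auto
    then show ?thesis by (simp add: mult.assoc)
  qed
  then show ?thesis using E by (meson ennreal_leI order.trans)
qed simp

text \<open>
  Changing \<open>u\<close> on a null set does not change the iterated integrals, so the energy can be taken of
  a Borel representative, for which Tonelli's theorem on \<^term>\<open>lborel\<close> is available.
\<close>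

lemma dissipation_ge_increment_energy:
  fixes u u' :: "real ^ 'n \<Rightarrow> real"
  assumes p: "2 \<le> p" and r: "0 < r"
    and J: "\<And>z. norm z < R \<Longrightarrow> r \<le> J z"
    and u': "u' \<in> borel_measurable borel" and ae: "AE x in lborel. u x = u' x"
  shows "ennreal (r / 2) * increment_energy R (\<lambda>x. phi (p / 2) (u' x)) \<le> dissipation p J u"
proof -
  let ?v = "\<lambda>x. phi (p / 2) (u x)" and ?v' = "\<lambda>x. phi (p / 2) (u' x)"
  let ?I = "\<lambda>f g. (\<integral>\<^sup>+ y. (\<integral>\<^sup>+ x. ennreal ((f x - g y)\<^sup>2) * indicator (ball y R) x \<partial>lborel) \<partial>lborel)"
  have [measurable]: "?v' \<in> borel_measurable borel" using u' by (auto simp: phi_def)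
  have "(\<lambda>(y, x). ennreal ((?v' x - ?v' y)\<^sup>2) * indicator {z. dist (fst z) (snd z) < R} (y, x))
      \<in> borel_measurable (lborel \<Otimes>\<^sub>M lborel)"
    by measurable
  also have "(\<lambda>(y, x). ennreal ((?v' x - ?v' y)\<^sup>2) * indicator {z. dist (fst z) (snd z) < R} (y, x))
      = (\<lambda>(y, x). ennreal ((?v' x - ?v' y)\<^sup>2) * indicator (ball y R) x)"
    by (auto simp: indicator_def)
  finally have outer: "(\<lambda>y. \<integral>\<^sup>+ x. ennreal ((?v' x - ?v' y)\<^sup>2) * indicator (ball y R) x \<partial>lborel)
      \<in> borel_measurable lborel"
    by (rule lborel.borel_measurable_nn_integral)
  have inner: "(\<lambda>x. ennreal ((?v' x - ?v' y)\<^sup>2) * indicator (ball y R) x) \<in> borel_measurable lborel" for y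
    by (intro borel_measurable_times_ennreal borel_measurable_indicator) auto
  have pt: "ennreal (r / p) * (ennreal ((?v x - ?v y)\<^sup>2) * indicator (ball y R) x)
      \<le> ennreal (J (x - y) * ((u x - u y) * (phi (p - 1) (u x) - phi (p - 1) (u y))))" for x y
  proof (cases "x \<in> ball y R")
    case True
    let ?D = "(u x - u y) * (phi (p - 1) (u x) - phi (p - 1) (u y))"
    have D: "(?v x - ?v y)\<^sup>2 \<le> p * ?D" using phi_half_diff_power2_le[OF p] .
    then have "0 \<le> p * ?D" by (rule order.trans[OF zero_le_power2])
    then have D0: "0 \<le> ?D" using p by (simp only: zero_le_mult_iff) linarith
    have "r / p * (?v x - ?v y)\<^sup>2 \<le> r / p * (p * ?D)"
      using D r p by (intro mult_left_mono) auto
    also have "\<dots> = r * ?D" using p by simp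
    also have "\<dots> \<le> J (x - y) * ?D"
      using True D0 by (intro mult_right_mono J) (auto simp: dist_norm norm_minus_commute)
    finally show ?thesis
      using True r p by (simp add: ennreal_leI flip: ennreal_mult)
  qed auto
  have "ennreal (r / 2) * increment_energy R ?v' = ennreal (p / 2) * (ennreal (r / p) * ?I ?v' ?v')"
    using p r by (simp add: increment_energy_eq_ball flip: mult.assoc ennreal_mult)
  also have "ennreal (r / p) * ?I ?v' ?v' =
      (\<integral>\<^sup>+ y. (\<integral>\<^sup>+ x. ennreal (r / p) * (ennreal ((?v' x - ?v' y)\<^sup>2) * indicator (ball y R) x) \<partial>lborel) \<partial>lborel)"
    by (simp only: nn_integral_cmult[OF inner] nn_integral_cmult[OF outer])
  also have "\<dots> =
      (\<integral>\<^sup>+ y. (\<integral>\<^sup>+ x. ennreal (r / p) * (ennreal ((?v x - ?v y)\<^sup>2) * indicator (ball y R) x) \<partial>lborel) \<partial>lborel)"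
  proof (rule nn_integral_cong_AE, use ae in eventually_elim)
    fix y assume y: "u y = u' y"
    show "(\<integral>\<^sup>+ x. ennreal (r / p) * (ennreal ((?v' x - ?v' y)\<^sup>2) * indicator (ball y R) x) \<partial>lborel)
      = (\<integral>\<^sup>+ x. ennreal (r / p) * (ennreal ((?v x - ?v y)\<^sup>2) * indicator (ball y R) x) \<partial>lborel)"
      by (rule nn_integral_cong_AE, use ae in eventually_elim) (simp add: y)
  qed
  also have "ennreal (p / 2) * \<dots> \<le> dissipation p J u"
    unfolding dissipation_def nn_integral_completion
    by (intro mult_left_mono nn_integral_mono pt) auto
  finally show ?thesis .
qed

theorem theorem1p1:
  fixes p \<gamma> :: real
  assumes "p \<ge> 2"
    and "\<gamma> = 2 / (real CARD('n::finite) * (p - 1))"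
  shows "\<exists>C::real. C > 0 \<and>
    (\<forall>(J :: real ^ 'n \<Rightarrow> real) (r::real) (R::real).
       J \<in> borel_measurable lebesgue \<longrightarrow> (\<forall>z. J z \<ge> 0) \<longrightarrow> r > 0 \<longrightarrow> R > 0 \<longrightarrow>
       (\<forall>z. norm z < R \<longrightarrow> J z \<ge> r) \<longrightarrow>
       (\<forall>u :: real ^ 'n \<Rightarrow> real. in_Lq 1 u \<longrightarrow> in_Lq p u \<longrightarrow>
          dissipation p J u \<ge>
            ennreal (C * r *
              min (R ^ (CARD('n) + 2) * Lq_norm 1 u powr (- p * \<gamma>) * Lq_norm p u powr (p * (1 + \<gamma>)))
                  (R ^ CARD('n) * Lq_norm p u powr p))))"
proof -
  define \<omega> where "\<omega> = unit_ball_vol (real CARD('n))"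
  define K where "K = (\<omega> / 4 * 2 powr (- 1 / (p - 1))) powr (2 / real CARD('n))"
  have \<omega>: "0 < \<omega>" by (simp add: \<omega>_def unit_ball_vol_pos)
  then have K: "0 < K" by (simp add: K_def)
  show ?thesis
  proof (intro exI[of _ "\<omega> * min 1 K / 128"] conjI allI impI)
    fix J :: "real ^ 'n \<Rightarrow> real" and r R :: real and u :: "real ^ 'n \<Rightarrow> real"
    assume r: "0 < r" and R: "0 < R" and J: "\<forall>z. norm z < R \<longrightarrow> r \<le> J z"
      and u1: "in_Lq 1 u" and up: "in_Lq p u"
    have um: "u \<in> borel_measurable lebesgue" using u1 by (simp add: in_Lq_def)
    then obtain u' where u': "u' \<in> borel_measurable lborel" and ae: "AE x in lborel. u x = u' x"
      using completion_ex_borel_measurable_real by blast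
    have borel: "u' \<in> borel_measurable borel" using u' by simp
    have aeq: "AE x in lebesgue. \<bar>u x\<bar> powr q = \<bar>u' x\<bar> powr q" for q
      using AE_completion[OF ae] by eventually_elim simp
    have mq: "(\<lambda>x. \<bar>u x\<bar> powr q) \<in> borel_measurable lebesgue"
      "(\<lambda>x. \<bar>u' x\<bar> powr q) \<in> borel_measurable lborel"
      "(\<lambda>x. \<bar>u' x\<bar> powr q) \<in> borel_measurable lebesgue" for q
      using um u' measurable_completion[OF u'] by measurable
    have int': "integrable lborel (\<lambda>x. \<bar>u' x\<bar> powr q)" if "in_Lq q u" for q
      using that integrable_cong_AE[OF mq(1,3) aeq, of q] integrable_completion[OF mq(2), of q]
      by (simp add: in_Lq_def)
    have norm': "(LINT x|lebesgue. \<bar>u x\<bar> powr q) = (\<integral>x. \<bar>u' x\<bar> powr q \<partial>lborel)" for q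
      using integral_cong_AE[OF mq(1,3) aeq] integral_completion[OF mq(2)] by simp
    have n0: "0 \<le> (\<integral>x. \<bar>u' x\<bar> powr q \<partial>lborel)" for q by simp
    have int1: "integrable lborel u'"
      using int'[OF u1] u' integrable_abs_iff[of u' lborel] by simp
    define A where "A = (\<integral>x. \<bar>u' x\<bar> \<partial>lborel)"
    define P where "P = (\<integral>x. \<bar>u' x\<bar> powr p \<partial>lborel)"
    have A: "Lq_norm 1 u = A" using norm'[of 1] by (simp add: Lq_norm_def A_def)
    have P: "Lq_norm p u powr p = P" "Lq_norm p u powr (p * (1 + \<gamma>)) = P powr (1 + \<gamma>)"
      using assms(1) n0[of p] by (simp_all add: Lq_norm_def norm' P_def powr_powr)
    define M where "M = min (R ^ (CARD('n) + 2) * A powr (- p * \<gamma>) * P powr (1 + \<gamma>)) (R ^ CARD('n) * P)"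
    have "ennreal (\<omega> * min 1 K / 128 * r * M) = ennreal (r / 2 * (\<omega> * min 1 K / 64 * M))"
      by (simp add: mult.assoc mult.left_commute[of r])
    also have "\<dots> = ennreal (r / 2) * ennreal (\<omega> * min 1 K / 64 * M)"
      using r by (intro ennreal_mult') simp
    also have "\<dots> \<le> ennreal (r / 2) * increment_energy R (\<lambda>x. phi (p / 2) (u' x))"
      using increment_energy_Nash[OF borel assms(1) int1 int'[OF up] R, of \<gamma>] assms(2)
      by (intro mult_left_mono) (simp_all add: \<omega>_def K_def M_def A_def P_def)
    also have "\<dots> \<le> dissipation p J u"
      using J by (intro dissipation_ge_increment_energy[OF assms(1) r _ borel ae]) auto
    finally show "ennreal (\<omega> * min 1 K / 128 * r *
        min (R ^ (CARD('n) + 2) * Lq_norm 1 u powr (- p * \<gamma>) * Lq_norm p u powr (p * (1 + \<gamma>)))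
          (R ^ CARD('n) * Lq_norm p u powr p)) \<le> dissipation p J u"
      unfolding A P M_def .
  qed (use \<omega> K in auto)
qed

end
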